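(* Let $\mathcal{F}$ be a block filter on $E$. Then $\mathcal{F}$ has the strong $(p)$-property if and only if for every $X\in E^{[\infty]}$ with $\langle X\rangle\in\mathcal{F}$ and every strategy $\sigma$ for player I in the restricted Gowers game $G_{\mathcal{F}}[X]$, there is an outcome $Y$ of $\sigma$ with $\langle Y\rangle\in\mathcal{F}$.
   Context: $E$ is a countably infinite-dimensional vector space over a countable field $F$ with fixed basis $(e_n)$; $\mathrm{supp}(v)$ for nonzero $v$ is the set of $i$ with $e_i$ having nonzero coefficient in $v$. A block sequence is a sequence $(x_n)$ of nonzero vectors with $\max\mathrm{supp}(x_n)<\min\mathrm{supp}(x_{n+1})$; $E^{[\infty]}$, $E^{[<\infty]}$ the sets of infinite and finite block sequences; $\langle X\rangle$ the span minus $0$; $Y\preceq X$ iff $\langle Y\rangle\subseteq\langle X\rangle$; $X/\vec x$ the tail of $X$ of vectors with supports above the supports of all entries of $\vec x$; $\vec x\sqsubseteq X$ means $\vec x$ is an initial segment of $X$. A filter on $E$ is a proper filter of subsets of $E\setminus\{0\}$ containing nonzero parts of all finite-codimensional subspaces; a block filter has a base of sets $\langle X\rangle$, $X\in E^{[\infty]}$. $\mathcal{F}$ has the strong $(p)$-property if whenever $\langle X_{\vec x}\rangle\in\mathcal{F}$ for all $\vec x\in E^{[<\infty]}$, there is $\langle X\rangle\in\mathcal{F}$ with $X/\vec x\preceq X_{\vec x}$ for all $\vec x\sqsubseteq X$. Restricted Gowers game $G_{\mathcal{F}}[X]$ (for $\langle X\rangle\in\mathcal{F}$): I and II alternate, I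 first; I plays $Y_k\in E^{[\infty]}$ with $Y_k\preceq X$ and $\langle Y_k\rangle\in\mathcal{F}$; II responds with $y_k\in\langle Y_k\rangle$ such that $(y_k)$ is a block sequence. The outcome of a round is $(y_k)$; an outcome of $\sigma$ is the outcome of a round in which I follows $\sigma$. *)

theory Defs
  imports Complex_Main "HOL-Library.Countable_Set"
begin

locale countable_vector_space = vector_space scale
  for scale :: "'a::field \<Rightarrow> 'b::ab_group_add \<Rightarrow> 'b" (infixr \<open>*s\<close> 75) +
  fixes e :: "nat \<Rightarrow> 'b"
  assumes countable_field: "countable (UNIV :: 'a set)"
    and inj_basis: "inj e"
    and independent_basis: "independent (range e)"
    and span_basis: "span (range e) = UNIV"
begin

definition supp :: "'b \<Rightarrow> nat set" where
  "supp v = {i. representation (range e) v (e i) \<noteq> 0}"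

definition block_seq :: "(nat \<Rightarrow> 'b) \<Rightarrow> bool" where
  "block_seq X \<longleftrightarrow> (\<forall>n. X n \<noteq> 0) \<and> (\<forall>n. Max (supp (X n)) < Min (supp (X (Suc n))))"

definition fin_block_seq :: "'b list \<Rightarrow> bool" where
  "fin_block_seq xs \<longleftrightarrow>
     (\<forall>n<length xs. xs ! n \<noteq> 0) \<and>
     (\<forall>n. Suc n < length xs \<longrightarrow> Max (supp (xs ! n)) < Min (supp (xs ! Suc n)))"

definition nz_span :: "(nat \<Rightarrow> 'b) \<Rightarrow> 'b set" where
  "nz_span X = span (range X) - {0}"

definition block_le :: "(nat \<Rightarrow> 'b) \<Rightarrow> (nat \<Rightarrow> 'b) \<Rightarrow> bool" where
  "block_le Y X \<longleftrightarrow> nz_span Y \<subseteq> nz_span X"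

text \<open>
  The supports in a block sequence increase, so the entries lying above \<open>xs\<close> form a final
  segment, which starts at the least such index. For empty \<open>xs\<close> this is all of \<open>X\<close>.
\<close>
definition tail_above :: "(nat \<Rightarrow> 'b) \<Rightarrow> 'b list \<Rightarrow> nat \<Rightarrow> 'b" where
  "tail_above X xs =
     (\<lambda>k. X (k + (LEAST n. \<forall>x\<in>set xs. Max (supp x) < Min (supp (X n)))))"

definition initial_segment :: "'b list \<Rightarrow> (nat \<Rightarrow> 'b) \<Rightarrow> bool" where
  "initial_segment xs X \<longleftrightarrow> xs = map X [0..<length xs]"

text \<open>\<open>E/V\<close> is finite-dimensional iff it is spanned by the images of a finite set \<open>B\<close>.\<close>
definition finite_codim_subspace :: "'b set \<Rightarrow> bool" where
  "finite_codim_subspace V \<longleftrightarrow> subspace V \<and> (\<exists>B. finite B \<and> span (V \<union> B) = UNIV)"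

definition vs_filter :: "'b set set \<Rightarrow> bool" where
  "vs_filter \<F> \<longleftrightarrow>
     (\<forall>A\<in>\<F>. A \<subseteq> UNIV - {0}) \<and>
     {} \<notin> \<F> \<and>
     (\<forall>A\<in>\<F>. \<forall>B\<in>\<F>. A \<inter> B \<in> \<F>) \<and>
     (\<forall>A\<in>\<F>. \<forall>B. A \<subseteq> B \<and> B \<subseteq> UNIV - {0} \<longrightarrow> B \<in> \<F>) \<and>
     (\<forall>V. finite_codim_subspace V \<longrightarrow> V - {0} \<in> \<F>)"

definition block_filter :: "'b set set \<Rightarrow> bool" where
  "block_filter \<F> \<longleftrightarrow>
     vs_filter \<F> \<and> (\<forall>A\<in>\<F>. \<exists>X. block_seq X \<and> nz_span X \<in> \<F> \<and> nz_span X \<subseteq> A)"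

definition strong_p_property :: "'b set set \<Rightarrow> bool" where
  "strong_p_property \<F> \<longleftrightarrow>
     (\<forall>Z :: 'b list \<Rightarrow> nat \<Rightarrow> 'b.
        (\<forall>xs. fin_block_seq xs \<longrightarrow> block_seq (Z xs) \<and> nz_span (Z xs) \<in> \<F>) \<longrightarrow>
        (\<exists>X. block_seq X \<and> nz_span X \<in> \<F> \<and>
             (\<forall>xs. initial_segment xs X \<longrightarrow> block_le (tail_above X xs) (Z xs))))"

definition legal_move_I :: "'b set set \<Rightarrow> (nat \<Rightarrow> 'b) \<Rightarrow> (nat \<Rightarrow> 'b) \<Rightarrow> bool" where
  "legal_move_I \<F> X Y \<longleftrightarrow> block_seq Y \<and> block_le Y X \<and> nz_span Y \<in> \<F>"

definition gowers_round ::
    "'b set set \<Rightarrow> (nat \<Rightarrow> 'b) \<Rightarrow> (nat \<Rightarrow> nat \<Rightarrow> 'b) \<Rightarrow> (nat \<Rightarrow> 'b) \<Rightarrow> bool" where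
  "gowers_round \<F> X Ys y \<longleftrightarrow>
     (\<forall>k. legal_move_I \<F> X (Ys k) \<and> y k \<in> nz_span (Ys k)) \<and> block_seq y"

text \<open>
  A strategy for I maps the list of II's previous moves to I's next move. It must be legal at
  every position \<open>ys\<close> that can arise when I follows it; its values elsewhere are irrelevant.
\<close>
definition strategy_I :: "'b set set \<Rightarrow> (nat \<Rightarrow> 'b) \<Rightarrow> ('b list \<Rightarrow> nat \<Rightarrow> 'b) \<Rightarrow> bool" where
  "strategy_I \<F> X \<sigma> \<longleftrightarrow>
     (\<forall>ys. fin_block_seq ys \<and> (\<forall>k<length ys. ys ! k \<in> nz_span (\<sigma> (take k ys))) \<longrightarrow>
        legal_move_I \<F> X (\<sigma> ys))"

definition outcome_I ::
    "'b set set \<Rightarrow> (nat \<Rightarrow> 'b) \<Rightarrow> ('b list \<Rightarrow> nat \<Rightarrow> 'b) \<Rightarrow> (nat \<Rightarrow> 'b) \<Rightarrow> bool" where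
  "outcome_I \<F> X \<sigma> y \<longleftrightarrow>
     (\<exists>Ys. gowers_round \<F> X Ys y \<and> (\<forall>k. Ys k = \<sigma> (map y [0..<k])))"

end

end

theory Submission
  imports Defs
begin

text \<open>
  For a block sequence \<open>Y\<close>, the tail above its first \<open>k\<close> entries starts with \<open>Y k\<close>. Hence the
  conclusion of the strong (p)-property says exactly that \<open>Y j\<close> lies in the span of
  \<open>Z (map Y [0..<k])\<close> for all \<open>k \<le> j\<close>. A strategy of I is itself a family \<open>Z\<close> (after replacing
  its values at unreachable positions by \<open>X\<close>), and the diagonal sequence of such a family is an
  outcome. Conversely, given \<open>Z\<close>, let I answer \<open>ys\<close> with a block sequence in the filter below
  \<open>Z\<close> at all initial segments of \<open>ys\<close>: every outcome is then diagonal for \<open>Z\<close>.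
\<close>

context countable_vector_space
begin

text \<open>By injectivity of \<open>e\<close>, a set of indices is finite once its image among the
  basis vectors is.\<close>

lemma finite_supp: "finite (supp v)"
proof -
  have "supp v = e -` {b. representation (range e) v b \<noteq> 0}"
    by (auto simp: supp_def)
  then show ?thesis
    by (metis finite_vimageI finite_representation inj_basis)
qed

lemma supp_nonempty:
  assumes "v \<noteq> 0"
  shows "supp v \<noteq> {}"
proof
  assume "supp v = {}"
  \<comment> \<open>Coefficients vanish off \<open>range e\<close>, so an empty support leaves no
    nonzero coefficient at all.\<close>
  then have "{b. representation (range e) v b \<noteq> 0} = {}"
    using representation_ne_zero[of "range e" v] by (auto simp: supp_def)
  then have "v = 0"
    using sum_nonzero_representation_eq[OF independent_basis, of v] by (simp add: span_basis)
  with assms show False ..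
qed

lemma Min_supp_le_Max_supp: "v \<noteq> 0 \<Longrightarrow> Min (supp v) \<le> Max (supp v)"
  by (simp add: finite_supp supp_nonempty)

lemma block_seq_less:
  assumes "block_seq X" "m < n"
  shows "Max (supp (X m)) < Min (supp (X n))"
  using \<open>m < n\<close>
proof (induction rule: less_Suc_induct)
  case (1 i)
  then show ?case using assms(1) by (simp add: block_seq_def)
next
  case (2 i j k)
  moreover have "Min (supp (X j)) \<le> Max (supp (X j))"
    using assms(1) by (simp add: block_seq_def Min_supp_le_Max_supp)
  ultimately show ?case by linarith
qed

lemma fin_block_seq_initial:
  "block_seq X \<Longrightarrow> fin_block_seq (map X [0..<k])"
  by (simp add: block_seq_def fin_block_seq_def)

text \<open>Entry \<open>k\<close> lies above all listed entries, whereas an entry \<open>n\<close>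
  with \<open>n < k\<close> is itself listed and cannot lie above itself.\<close>

lemma tail_above_initial:
  assumes "block_seq X"
  shows "tail_above X (map X [0..<k]) = (\<lambda>i. X (i + k))"
proof -
  have "(LEAST n. \<forall>x\<in>set (map X [0..<k]). Max (supp x) < Min (supp (X n))) = k"
  proof (rule Least_equality)
    show "\<forall>x\<in>set (map X [0..<k]). Max (supp x) < Min (supp (X k))"
      using block_seq_less[OF assms] by auto
  next
    fix n
    assume n: "\<forall>x\<in>set (map X [0..<k]). Max (supp x) < Min (supp (X n))"
    show "k \<le> n"
    proof (rule ccontr)
      assume "\<not> k \<le> n"
      with n have "Max (supp (X n)) < Min (supp (X n))" by simp
      moreover have "Min (supp (X n)) \<le> Max (supp (X n))"
        using assms by (simp add: block_seq_def Min_supp_le_Max_supp)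
      ultimately show False by simp
    qed
  qed
  then show ?thesis by (simp add: tail_above_def)
qed

lemma block_le_iff:
  assumes "\<And>i. Y i \<noteq> 0"
  shows "block_le Y X \<longleftrightarrow> (\<forall>i. Y i \<in> nz_span X)"
proof
  assume "block_le Y X"
  then show "\<forall>i. Y i \<in> nz_span X"
    using assms span_base[of _ "range Y"] unfolding block_le_def nz_span_def by blast
next
  assume "\<forall>i. Y i \<in> nz_span X"
  then have "span (range Y) \<subseteq> span (range X)"
    by (intro span_minimal) (auto simp: nz_span_def)
  then show "block_le Y X" by (auto simp: block_le_def nz_span_def)
qed

text \<open>Pointwise form matching the game: the case \<open>k = j\<close> says that
  \<open>X j\<close> is a legal answer to the move \<open>Z (map X [0..<j])\<close>.\<close>

lemma diagonal_iff:
  assumes "block_seq X"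
  shows "(\<forall>xs. initial_segment xs X \<longrightarrow> block_le (tail_above X xs) (Z xs)) \<longleftrightarrow>
    (\<forall>k j. k \<le> j \<longrightarrow> X j \<in> nz_span (Z (map X [0..<k])))"
proof -
  have nz: "X j \<noteq> 0" for j using assms by (simp add: block_seq_def)
  have "(\<forall>xs. initial_segment xs X \<longrightarrow> block_le (tail_above X xs) (Z xs)) \<longleftrightarrow>
    (\<forall>k. block_le (tail_above X (map X [0..<k])) (Z (map X [0..<k])))"
  proof (intro iffI allI impI)
    fix k
    assume "\<forall>xs. initial_segment xs X \<longrightarrow> block_le (tail_above X xs) (Z xs)"
    moreover have "initial_segment (map X [0..<k]) X" by (simp add: initial_segment_def)
    ultimately show "block_le (tail_above X (map X [0..<k])) (Z (map X [0..<k]))" by blast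
  next
    fix xs
    assume "\<forall>k. block_le (tail_above X (map X [0..<k])) (Z (map X [0..<k]))"
      and "initial_segment xs X"
    \<comment> \<open>The equation for \<open>xs\<close> has \<open>xs\<close> on both sides, so it
      is substituted once instead of being used as a rewrite rule.\<close>
    then show "block_le (tail_above X xs) (Z xs)"
      unfolding initial_segment_def by (elim ssubst) blast
  qed
  also have "\<dots> \<longleftrightarrow> (\<forall>k i. X (i + k) \<in> nz_span (Z (map X [0..<k])))"
    by (simp add: tail_above_initial[OF assms] block_le_iff nz)
  also have "\<dots> \<longleftrightarrow> (\<forall>k j. k \<le> j \<longrightarrow> X j \<in> nz_span (Z (map X [0..<k])))"
    by (auto simp: le_iff_add add.commute)
  finally show ?thesis .
qed

text \<open>Induction from binary intersections. The intersection over an empty \<open>I\<close>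
  would be \<open>UNIV\<close>, which contains 0 and is outside the filter.\<close>

lemma vs_filter_INT:
  assumes "vs_filter \<F>" "finite I" "I \<noteq> {}" "\<And>i. i \<in> I \<Longrightarrow> A i \<in> \<F>"
  shows "(\<Inter>i\<in>I. A i) \<in> \<F>"
  using assms(2-4)
proof (induction rule: finite_ne_induct)
  case (insert i I)
  have "\<forall>A\<in>\<F>. \<forall>B\<in>\<F>. A \<inter> B \<in> \<F>"
    using assms(1) unfolding vs_filter_def by blast
  with insert show ?case by simp
qed simp

lemma strong_p_imp_outcome_in_filter:
  assumes "strong_p_property \<F>" "block_seq X" "nz_span X \<in> \<F>" "strategy_I \<F> X \<sigma>"
  shows "\<exists>Y. outcome_I \<F> X \<sigma> Y \<and> nz_span Y \<in> \<F>"
proof -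
  \<comment> \<open>A strategy is constrained at reachable positions only, but the strong
    (p)-property wants a family on all finite block sequences; \<open>X\<close> is a safe
    default.\<close>
  define Z where "Z = (\<lambda>xs. if legal_move_I \<F> X (\<sigma> xs) then \<sigma> xs else X)"
  have "block_seq (Z xs) \<and> nz_span (Z xs) \<in> \<F>" for xs
    using assms(2,3) by (simp add: Z_def legal_move_I_def)
  then obtain Y where Y: "block_seq Y" "nz_span Y \<in> \<F>"
    and "\<forall>xs. initial_segment xs Y \<longrightarrow> block_le (tail_above Y xs) (Z xs)"
    using assms(1) unfolding strong_p_property_def by blast
  then have diag: "Y k \<in> nz_span (Z (map Y [0..<k]))" for k
    using diagonal_iff by blast
  \<comment> \<open>Legality of the moves before \<open>k\<close> gives \<open>Z = \<sigma>\<close>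
    there, so \<open>diag\<close> makes position \<open>k\<close> reachable and the strategy legal
    at it.\<close>
  have legal: "legal_move_I \<F> X (\<sigma> (map Y [0..<k]))" for k
  proof (induction k rule: less_induct)
    case (less k)
    have "map Y [0..<k] ! i \<in> nz_span (\<sigma> (take i (map Y [0..<k])))" if "i < k" for i
      using diag[of i] less[OF that] that by (simp add: take_map Z_def)
    then show ?case
      using assms(4) fin_block_seq_initial[OF Y(1)] by (simp add: strategy_I_def)
  qed
  then have "Y k \<in> nz_span (\<sigma> (map Y [0..<k]))" for k
    using diag[of k] by (simp add: Z_def)
  with legal Y(1) have "outcome_I \<F> X \<sigma> Y"
    unfolding outcome_I_def gowers_round_def
    by (intro exI[of _ "\<lambda>k. \<sigma> (map Y [0..<k])"]) simp
  with Y(2) show ?thesis by blast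
qed

lemma outcome_in_filter_imp_strong_p:
  assumes "block_filter \<F>"
    and outcome: "\<And>X \<sigma>. block_seq X \<Longrightarrow> nz_span X \<in> \<F> \<Longrightarrow> strategy_I \<F> X \<sigma> \<Longrightarrow>
      \<exists>Y. outcome_I \<F> X \<sigma> Y \<and> nz_span Y \<in> \<F>"
  shows "strong_p_property \<F>"
  unfolding strong_p_property_def
proof (intro allI impI)
  fix Z :: "'b list \<Rightarrow> nat \<Rightarrow> 'b"
  assume Z: "\<forall>xs. fin_block_seq xs \<longrightarrow> block_seq (Z xs) \<and> nz_span (Z xs) \<in> \<F>"
  \<comment> \<open>The bound includes \<open>j = 0\<close>, which keeps I's moves below
    \<open>Z []\<close>, and \<open>j = length ys\<close>, which contributes \<open>Z ys\<close>
    itself.\<close>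
  define below where "below = (\<lambda>ys. \<Inter>j\<in>{..length ys}. nz_span (Z (take j ys)))"
  have below: "below ys \<in> \<F>" if "fin_block_seq ys" for ys
  proof -
    have "fin_block_seq (take j ys)" for j
      using that by (simp add: fin_block_seq_def)
    with Z assms(1) show ?thesis
      unfolding below_def by (intro vs_filter_INT) (auto simp: block_filter_def)
  qed
  \<comment> \<open>With the implication under the quantifier a witness exists for every list, so
    choice yields a total \<open>\<sigma>\<close>.\<close>
  have "\<exists>Y. fin_block_seq ys \<longrightarrow> block_seq Y \<and> nz_span Y \<in> \<F> \<and> nz_span Y \<subseteq> below ys" for ys
    using below assms(1) unfolding block_filter_def by blast
  then obtain \<sigma> where \<sigma>: "\<And>ys. fin_block_seq ys \<Longrightarrow>
      block_seq (\<sigma> ys) \<and> nz_span (\<sigma> ys) \<in> \<F> \<and> nz_span (\<sigma> ys) \<subseteq> below ys"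
    by metis
  \<comment> \<open>The term \<open>j = 0\<close>; it makes \<open>\<sigma>\<close> a strategy in
    the game on \<open>Z []\<close>.\<close>
  have "below ys \<subseteq> nz_span (Z [])" for ys
    unfolding below_def by force
  then have "strategy_I \<F> (Z []) \<sigma>"
    using \<sigma> unfolding strategy_I_def legal_move_I_def block_le_def by blast
  moreover have "fin_block_seq []" by (simp add: fin_block_seq_def)
  ultimately obtain Y where out: "outcome_I \<F> (Z []) \<sigma> Y" and Y_in: "nz_span Y \<in> \<F>"
    using outcome Z by blast
  then have Y: "block_seq Y" and move: "\<And>j. Y j \<in> nz_span (\<sigma> (map Y [0..<j]))"
    by (auto simp: outcome_I_def gowers_round_def)
  have "Y j \<in> nz_span (Z (map Y [0..<k]))" if "k \<le> j" for k j
  proof -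
    have "Y j \<in> below (map Y [0..<j])"
      using move \<sigma>[OF fin_block_seq_initial[OF Y]] by blast
    \<comment> \<open>Since \<open>k \<le> j\<close>, the prefix of length \<open>k\<close> is among
      those intersected at round \<open>j\<close>.\<close>
    then have "Y j \<in> nz_span (Z (take k (map Y [0..<j])))"
      using that by (simp add: below_def)
    then show ?thesis using that by (simp add: take_map)
  qed
  with Y Y_in show "\<exists>X. block_seq X \<and> nz_span X \<in> \<F> \<and>
      (\<forall>xs. initial_segment xs X \<longrightarrow> block_le (tail_above X xs) (Z xs))"
    using diagonal_iff by blast
qed

end

theorem theorem5p1:
  fixes scale :: "'a::field \<Rightarrow> 'b::ab_group_add \<Rightarrow> 'b"
    and e :: "nat \<Rightarrow> 'b"
    and \<F> :: "'b set set"
  assumes "countable_vector_space scale e"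
    and "countable_vector_space.block_filter scale e \<F>"
  shows "countable_vector_space.strong_p_property scale e \<F> \<longleftrightarrow>
    (\<forall>X. countable_vector_space.block_seq scale e X \<and>
          countable_vector_space.nz_span scale X \<in> \<F> \<longrightarrow>
      (\<forall>\<sigma>. countable_vector_space.strategy_I scale e \<F> X \<sigma> \<longrightarrow>
        (\<exists>Y. countable_vector_space.outcome_I scale e \<F> X \<sigma> Y \<and>
             countable_vector_space.nz_span scale Y \<in> \<F>)))"
proof -
  interpret countable_vector_space scale e by fact
  show ?thesis
  proof (intro iffI allI impI)
    fix X \<sigma>
    assume "strong_p_property \<F>" "block_seq X \<and> nz_span X \<in> \<F>" "strategy_I \<F> X \<sigma>"
    then show "\<exists>Y. outcome_I \<F> X \<sigma> Y \<and> nz_span Y \<in> \<F>"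
      by (intro strong_p_imp_outcome_in_filter) auto
  next
    assume "\<forall>X. block_seq X \<and> nz_span X \<in> \<F> \<longrightarrow>
      (\<forall>\<sigma>. strategy_I \<F> X \<sigma> \<longrightarrow> (\<exists>Y. outcome_I \<F> X \<sigma> Y \<and> nz_span Y \<in> \<F>))"
    then show "strong_p_property \<F>"
      by (intro outcome_in_filter_imp_strong_p[OF assms(2)]) auto
  qed
qed

end
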